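(* Let $n\ge 1$ and let $(\tau_\mu)$ be complex numbers indexed by the horizontal tableaux $\mu$ of shape $\mathbf{2\times n}$ such that $\sum_{\mu\perp\nu}\tau_\mu=0$ for every vertical tableau $\nu$ of shape $\mathbf{2\times n}$. Then for every $k<n$ and every partial tableau $\nu'$ of shape $\mathbf{2\times k}$, we have $\sum_{\mu\perp\nu'}\tau_\mu=0$, where the sum is over horizontal tableaux $\mu$ of shape $\mathbf{2\times n}$ orthogonal to $\nu'$.
   Context: A horizontal tableau of shape $\mathbf{2\times n}$ is an unordered partition of $\{1,\dots,2n\}$ into two $n$-element sets (its rows). A vertical tableau of shape $\mathbf{2\times n}$ is a partition of $\{1,\dots,2n\}$ into $n$ two-element sets (its columns). A horizontal tableau $\mu$ and a vertical tableau $\nu$ are orthogonal, $\mu\perp\nu$, if every row of $\mu$ meets every column of $\nu$ in at most one element. For $k<n$, a subtableau of shape $\mathbf{2\times k}$ of a vertical tableau $\nu$ of shape $\mathbf{2\times n}$ is a subset of $k$ of its columns; a partial tableau of shape $\mathbf{2\times k}$ is a collection of $k$ pairwise disjoint two-element subsets of $\{1,\dots,2n\}$ (equivalently, a subtableau of at least one vertical tableau of shape $\mathbf{2\times n}$). A horizontal tableau $\mu$ of shape $\mathbf{2\times n}$ is orthogonal to a partial tableau $\nu'$, written $\mu\perp\nu'$, if there exists a vertical tableau $\nu$ of shape $\mathbf{2\times n}$ with $\mu\perp\nu$ and $\nu'$ a subtableau of $\nu$. *)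

theory Defs
  imports Complex_Main "HOL-Library.Disjoint_Sets"
begin

definition horizontal_tableau :: "nat \<Rightarrow> nat set set \<Rightarrow> bool" where
  "horizontal_tableau n \<mu> \<longleftrightarrow>
     partition_on {1..2*n} \<mu> \<and> card \<mu> = 2 \<and> (\<forall>R\<in>\<mu>. card R = n)"

definition vertical_tableau :: "nat \<Rightarrow> nat set set \<Rightarrow> bool" where
  "vertical_tableau n \<nu> \<longleftrightarrow>
     partition_on {1..2*n} \<nu> \<and> card \<nu> = n \<and> (\<forall>C\<in>\<nu>. card C = 2)"

definition orthogonal_tableaux :: "nat set set \<Rightarrow> nat set set \<Rightarrow> bool" where
  "orthogonal_tableaux \<mu> \<nu> \<longleftrightarrow> (\<forall>R\<in>\<mu>. \<forall>C\<in>\<nu>. card (R \<inter> C) \<le> 1)"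

definition subtableau :: "nat \<Rightarrow> nat set set \<Rightarrow> nat set set \<Rightarrow> bool" where
  "subtableau k \<nu>' \<nu> \<longleftrightarrow> \<nu>' \<subseteq> \<nu> \<and> card \<nu>' = k"

text \<open>Members lie in the finite set \<open>{1..2*n}\<close>, so the collection is automatically finite
  and \<open>card \<nu>' = 0\<close> really means that it is empty.\<close>

definition partial_tableau :: "nat \<Rightarrow> nat \<Rightarrow> nat set set \<Rightarrow> bool" where
  "partial_tableau n k \<nu>' \<longleftrightarrow>
     card \<nu>' = k \<and> disjoint \<nu>' \<and> (\<forall>C\<in>\<nu>'. C \<subseteq> {1..2*n} \<and> card C = 2)"

definition orthogonal_partial :: "nat \<Rightarrow> nat \<Rightarrow> nat set set \<Rightarrow> nat set set \<Rightarrow> bool" where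
  "orthogonal_partial n k \<mu> \<nu>' \<longleftrightarrow>
     (\<exists>\<nu>. vertical_tableau n \<nu> \<and> orthogonal_tableaux \<mu> \<nu> \<and> subtableau k \<nu>' \<nu>)"

end

theory Submission
  imports Defs
begin

text \<open>
  A horizontal tableau that separates the two entries of every column of a partial tableau
  \<open>\<nu>'\<close> with \<open>k < n\<close> columns leaves \<open>n - k\<close> uncovered entries in each of its rows. Hence, for an
  uncovered \<open>a\<close>, exactly \<open>n - k\<close> of the columns \<open>{a, b}\<close> disjoint from \<open>\<nu>'\<close> can be added to \<open>\<nu>'\<close>
  without losing orthogonality. Double counting over \<open>b\<close> expresses \<open>n - k\<close> times the sum at
  \<open>\<nu>'\<close> through the sums at partial tableaux with \<open>k + 1\<close> columns, and descending induction on
  \<open>k\<close> starts at \<open>k = n\<close>, where partial tableaux are vertical tableaux.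
\<close>

lemma horizontal_tableau_rowsE:
  assumes "horizontal_tableau n \<mu>" "a \<in> {1..2*n}"
  obtains R T where "\<mu> = {R, T}" "a \<in> R" "R \<inter> T = {}" "R \<union> T = {1..2*n}" "card R = n" "card T = n"
proof -
  have p: "partition_on {1..2*n} \<mu>" and c: "card \<mu> = 2" and rows: "\<forall>R\<in>\<mu>. card R = n"
    using assms(1) by (auto simp: horizontal_tableau_def)
  obtain R where R: "R \<in> \<mu>" "a \<in> R"
    using p assms(2) by (metis UnionE partition_onD1)
  obtain T where T: "\<mu> = {R, T}" "R \<noteq> T"
    using c R(1) by (auto simp: card_2_iff)
  have "R \<inter> T = {}"
    using partition_onD2[OF p] T by (auto simp: disjoint_def)
  moreover have "R \<union> T = {1..2*n}"
    using partition_onD1[OF p] T(1) by auto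
  ultimately show thesis
    using that T(1) R(2) rows by blast
qed

lemma finite_horizontal_tableaux: "finite {\<mu>. horizontal_tableau n \<mu>}"
proof (rule finite_subset)
  show "{\<mu>. horizontal_tableau n \<mu>} \<subseteq> Pow (Pow {1..2*n})"
    by (auto simp: horizontal_tableau_def partition_on_def)
qed simp

lemma finite_partial_tableau: "partial_tableau n k \<nu> \<Longrightarrow> finite \<nu>"
  by (rule finite_subset[of _ "Pow {1..2*n}"]) (auto simp: partial_tableau_def)

lemma card_Union_partial_tableau:
  assumes "partial_tableau n k \<nu>"
  shows "card (\<Union>\<nu>) = 2 * k"
proof -
  have "card (\<Union>\<nu>) = sum card \<nu>"
    using assms by (intro card_Union_disjoint)
      (auto simp: partial_tableau_def disjoint_def pairwise_def disjnt_def
        intro: card_ge_0_finite)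
  also have "\<dots> = (\<Sum>C\<in>\<nu>. 2)"
    using assms by (intro sum.cong) (auto simp: partial_tableau_def)
  finally show ?thesis
    using assms by (simp add: partial_tableau_def)
qed

text \<open>Disjoint pairs cover twice as many entries as there are pairs, so \<open>n\<close> of
  them exhaust \<open>{1..2*n}\<close>. This supplies the base case of both descending
  inductions.\<close>

lemma partial_tableau_full:
  assumes "partial_tableau n n \<nu>"
  shows "vertical_tableau n \<nu>"
proof -
  have sub: "\<Union>\<nu> \<subseteq> {1..2*n}"
    using assms unfolding partial_tableau_def by blast
  have "\<Union>\<nu> = {1..2*n}"
    using card_Union_partial_tableau[OF assms] by (intro card_subset_eq sub) auto
  moreover have "{} \<notin> \<nu>"
    using assms by (auto simp: partial_tableau_def)
  ultimately show ?thesis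
    using assms by (auto simp: vertical_tableau_def partial_tableau_def partition_on_def)
qed

lemma partial_tableau_insert:
  assumes "partial_tableau n k \<nu>" "a \<in> {1..2*n} - \<Union>\<nu>" "b \<in> {1..2*n} - \<Union>\<nu> - {a}"
  shows "partial_tableau n (Suc k) (insert {a, b} \<nu>)"
proof -
  have "{a, b} \<notin> \<nu>"
    using assms(2) by auto
  then have "card (insert {a, b} \<nu>) = Suc k"
    using assms(1) finite_partial_tableau[OF assms(1)] by (simp add: partial_tableau_def)
  moreover have "disjoint (insert {a, b} \<nu>)"
    using assms by (intro disjointI) (auto simp: partial_tableau_def disjoint_def)
  moreover have "card {a, b} = 2"
    using assms(3) by auto
  ultimately show ?thesis
    using assms unfolding partial_tableau_def by auto
qed

lemma partial_tableau_uncovered: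
  assumes "partial_tableau n k \<nu>" "k < n"
  obtains a where "a \<in> {1..2*n} - \<Union>\<nu>"
proof -
  have "\<Union>\<nu> \<subseteq> {1..2*n}"
    using assms(1) unfolding partial_tableau_def by blast
  moreover have "\<Union>\<nu> \<noteq> {1..2*n}"
    using card_Union_partial_tableau[OF assms(1)] assms(2) by auto
  ultimately show thesis
    using that by blast
qed

text \<open>Let \<open>T\<close> be the row of \<mu> that does not contain \<open>a\<close>. The
  admissible partners \<open>b\<close> are exactly the entries of \<open>T\<close> left uncovered by
  \<nu>, and the \<open>k\<close> columns of \<nu> use up one entry of \<open>T\<close>
  each.\<close>

lemma card_orthogonal_extensions:
  assumes h: "horizontal_tableau n \<mu>" and p: "partial_tableau n k \<nu>"
    and orth: "orthogonal_tableaux \<mu> \<nu>" and a: "a \<in> {1..2*n} - \<Union>\<nu>"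
  shows "card {b \<in> {1..2*n} - \<Union>\<nu> - {a}. orthogonal_tableaux \<mu> (insert {a, b} \<nu>)} = n - k"
proof -
  obtain R T where RT: "\<mu> = {R, T}" "a \<in> R" "R \<inter> T = {}" "R \<union> T = {1..2*n}"
    "card R = n" "card T = n"
    using horizontal_tableau_rowsE[OF h, of a] a by blast
  have finT: "finite T"
    using RT(4) by (metis finite_Un finite_atLeastAtMost)
  \<comment> \<open>The two entries of \<open>C\<close> are shared out between \<open>R\<close> and
    \<open>T\<close>, at most one to each, so each row gets exactly one.\<close>
  have one: "card (T \<inter> C) = 1" if C: "C \<in> \<nu>" for C
  proof -
    have C2: "C \<subseteq> {1..2*n}" "card C = 2"
      using p C by (auto simp: partial_tableau_def)
    have "finite C"
      using C2(1) finite_subset by blast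
    then have "card ((R \<inter> C) \<union> (T \<inter> C)) = card (R \<inter> C) + card (T \<inter> C)"
      using RT(3) by (intro card_Un_disjoint) auto
    moreover have "(R \<inter> C) \<union> (T \<inter> C) = C"
      using C2(1) RT(4) by auto
    moreover have "card (R \<inter> C) \<le> 1" "card (T \<inter> C) \<le> 1"
      using orth C RT(1) by (auto simp: orthogonal_tableaux_def)
    ultimately show ?thesis
      using C2(2) by simp
  qed
  have "card (\<Union>C\<in>\<nu>. T \<inter> C) = (\<Sum>C\<in>\<nu>. card (T \<inter> C))"
    using p finT by (intro card_UN_disjoint finite_partial_tableau[OF p])
      (auto simp: partial_tableau_def disjoint_def)
  also have "\<dots> = k"
    using p one by (simp add: partial_tableau_def)
  finally have "card (T \<inter> \<Union>\<nu>) = k"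
    by (simp only: Int_Union)
  then have cardT: "card (T - \<Union>\<nu>) = n - k"
    using card_Diff_subset_Int[of T "\<Union>\<nu>"] finT RT(6) by simp
  have sep: "orthogonal_tableaux \<mu> (insert {a, b} \<nu>) \<longleftrightarrow> b \<in> T"
    if b: "b \<in> {1..2*n} - \<Union>\<nu> - {a}" for b
  proof (cases "b \<in> T")
    case True
    then have "R \<inter> {a, b} = {a}" "T \<inter> {a, b} = {b}"
      using RT(2,3) by auto
    then show ?thesis
      using orth RT(1) True by (auto simp: orthogonal_tableaux_def)
  next
    case False
    then have "R \<inter> {a, b} = {a, b}"
      using b RT(2,4) by auto
    then have "card (R \<inter> {a, b}) = 2"
      using b by auto
    then show ?thesis
      using RT(1) False by (auto simp: orthogonal_tableaux_def)
  qed
  have "{b \<in> {1..2*n} - \<Union>\<nu> - {a}. orthogonal_tableaux \<mu> (insert {a, b} \<nu>)}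
      = {b \<in> {1..2*n} - \<Union>\<nu> - {a}. b \<in> T}"
    using sep by (intro Collect_cong conj_cong) auto
  also have "\<dots> = T - \<Union>\<nu>"
    using RT(2-4) by blast
  finally show ?thesis
    using cardT by simp
qed

text \<open>This removes the existential over completions, so that the sums can be compared column
  by column. A completion is built greedily: while fewer than \<open>n\<close> columns are present,
  the number of orthogonal extensions is positive.\<close>

lemma orthogonal_partial_iff:
  assumes "horizontal_tableau n \<mu>" "partial_tableau n k \<nu>'" "k \<le> n"
  shows "orthogonal_partial n k \<mu> \<nu>' \<longleftrightarrow> orthogonal_tableaux \<mu> \<nu>'"
proof
  assume "orthogonal_partial n k \<mu> \<nu>'"
  then show "orthogonal_tableaux \<mu> \<nu>'"
    by (auto simp: orthogonal_partial_def orthogonal_tableaux_def subtableau_def)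
next
  \<comment> \<open>Only inclusion is claimed here, because \<open>k\<close> varies in the
    induction; the cardinality demanded by \<open>subtableau\<close> comes from
    \<open>partial_tableau\<close> at the end.\<close>
  have "\<exists>\<nu>. vertical_tableau n \<nu> \<and> orthogonal_tableaux \<mu> \<nu> \<and> \<nu>' \<subseteq> \<nu>"
    if "orthogonal_tableaux \<mu> \<nu>'"
    using assms(3,2) that
  proof (induction k arbitrary: \<nu>' rule: inc_induct)
    case base
    then show ?case
      using partial_tableau_full by blast
  next
    case (step k)
    obtain a where a: "a \<in> {1..2*n} - \<Union>\<nu>'"
      using partial_tableau_uncovered step.prems(1) step.hyps(2) by blast
    have "card {b \<in> {1..2*n} - \<Union>\<nu>' - {a}. orthogonal_tableaux \<mu> (insert {a, b} \<nu>')} \<noteq> 0"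
      unfolding card_orthogonal_extensions[OF assms(1) step.prems a] using step.hyps(2) by simp
    then have "{b \<in> {1..2*n} - \<Union>\<nu>' - {a}. orthogonal_tableaux \<mu> (insert {a, b} \<nu>')} \<noteq> {}"
      by (metis (no_types, lifting) card.empty)
    then obtain b where b: "b \<in> {1..2*n} - \<Union>\<nu>' - {a}" "orthogonal_tableaux \<mu> (insert {a, b} \<nu>')"
      by blast
    show ?case
      using step.IH[OF partial_tableau_insert[OF step.prems(1) a b(1)] b(2)] by auto
  qed
  moreover assume "orthogonal_tableaux \<mu> \<nu>'"
  ultimately show "orthogonal_partial n k \<mu> \<nu>'"
    using assms(2) by (auto simp: orthogonal_partial_def subtableau_def partial_tableau_def)
qed

lemma sum_orthogonal_extensions:
  fixes \<tau> :: "nat set set \<Rightarrow> 'a::semiring_1"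
  assumes p: "partial_tableau n k \<nu>" and a: "a \<in> {1..2*n} - \<Union>\<nu>"
  shows "(\<Sum>b\<in>{1..2*n} - \<Union>\<nu> - {a}.
            \<Sum>\<mu> | horizontal_tableau n \<mu> \<and> orthogonal_tableaux \<mu> (insert {a, b} \<nu>). \<tau> \<mu>)
       = of_nat (n - k) * (\<Sum>\<mu> | horizontal_tableau n \<mu> \<and> orthogonal_tableaux \<mu> \<nu>. \<tau> \<mu>)"
    (is "?L = _")
proof -
  let ?H = "{\<mu>. horizontal_tableau n \<mu>}" and ?B = "{1..2*n} - \<Union>\<nu> - {a}"
  let ?o = "\<lambda>\<mu> b. orthogonal_tableaux \<mu> (insert {a, b} \<nu>)"
  have "?L = (\<Sum>b\<in>?B. \<Sum>\<mu> | \<mu> \<in> ?H \<and> ?o \<mu> b. \<tau> \<mu>)"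
    by simp
  \<comment> \<open>After the exchange, \<tau> \<mu> is constant in the inner sum, which therefore
    only counts the admissible \<open>b\<close>.\<close>
  also have "\<dots> = (\<Sum>\<mu>\<in>?H. \<Sum>b | b \<in> ?B \<and> ?o \<mu> b. \<tau> \<mu>)"
    by (intro sum.swap_restrict finite_horizontal_tableaux) simp
  also have "\<dots> = (\<Sum>\<mu>\<in>?H. if orthogonal_tableaux \<mu> \<nu> then of_nat (n - k) * \<tau> \<mu> else 0)"
  proof (intro sum.cong refl)
    fix \<mu> assume "\<mu> \<in> ?H"
    show "(\<Sum>b | b \<in> ?B \<and> ?o \<mu> b. \<tau> \<mu>)
        = (if orthogonal_tableaux \<mu> \<nu> then of_nat (n - k) * \<tau> \<mu> else 0)"
    proof (cases "orthogonal_tableaux \<mu> \<nu>")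
      case True
      then show ?thesis
        using card_orthogonal_extensions[OF _ p True a] \<open>\<mu> \<in> ?H\<close> by simp
    next
      case False
      \<comment> \<open>Orthogonality is inherited by smaller sets of columns, so a \<mu> that fails
        for \<nu> fails for every extension.\<close>
      then have "{b. b \<in> ?B \<and> ?o \<mu> b} = {}"
        by (auto simp: orthogonal_tableaux_def)
      with False show ?thesis
        by (simp only: sum.empty if_False)
    qed
  qed
  also have "\<dots> = (\<Sum>\<mu> | horizontal_tableau n \<mu> \<and> orthogonal_tableaux \<mu> \<nu>. of_nat (n - k) * \<tau> \<mu>)"
    using finite_horizontal_tableaux by (simp add: sum.inter_filter[symmetric])
  finally show ?thesis
    by (simp add: sum_distrib_left)
qed

theorem theorem2p3:
  fixes n :: nat and \<tau> :: "nat set set \<Rightarrow> complex"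
  assumes "n \<ge> 1"
    and "\<And>\<nu>. vertical_tableau n \<nu> \<Longrightarrow>
           (\<Sum>\<mu> | horizontal_tableau n \<mu> \<and> orthogonal_tableaux \<mu> \<nu>. \<tau> \<mu>) = 0"
  shows "\<forall>k<n. \<forall>\<nu>'. partial_tableau n k \<nu>' \<longrightarrow>
           (\<Sum>\<mu> | horizontal_tableau n \<mu> \<and> orthogonal_partial n k \<mu> \<nu>'. \<tau> \<mu>) = 0"
proof (intro allI impI)
  fix k \<nu>'
  assume "k < n" and p: "partial_tableau n k \<nu>'"
  then have "k \<le> n"
    by simp
  have "{\<mu>. horizontal_tableau n \<mu> \<and> orthogonal_partial n k \<mu> \<nu>'}
      = {\<mu>. horizontal_tableau n \<mu> \<and> orthogonal_tableaux \<mu> \<nu>'}"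
    using orthogonal_partial_iff[OF _ p \<open>k \<le> n\<close>] by blast
  moreover have "(\<Sum>\<mu> | horizontal_tableau n \<mu> \<and> orthogonal_tableaux \<mu> \<nu>'. \<tau> \<mu>) = 0"
    using \<open>k \<le> n\<close> p
  proof (induction k arbitrary: \<nu>' rule: inc_induct)
    case base
    then show ?case
      by (intro assms(2) partial_tableau_full)
  next
    case (step k)
    obtain a where a: "a \<in> {1..2*n} - \<Union>\<nu>'"
      using partial_tableau_uncovered step.prems step.hyps(2) by blast
    \<comment> \<open>Read backwards, the double count turns the left side into a sum over
      \<open>b\<close> of sums for \<open>Suc k\<close> columns, all zero by induction.\<close>
    have "of_nat (n - k) * (\<Sum>\<mu> | horizontal_tableau n \<mu> \<and> orthogonal_tableaux \<mu> \<nu>'. \<tau> \<mu>) = 0"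
      unfolding sum_orthogonal_extensions[OF step.prems a, symmetric]
      by (intro sum.neutral ballI step.IH partial_tableau_insert[OF step.prems a])
    with step.hyps(2) show ?case
      \<comment> \<open>Keeping \<open>of_nat (n - k)\<close> unsplit lets it be recognized as
        nonzero from \<open>k < n\<close> and cancelled.\<close>
      by (simp del: of_nat_diff)
  qed
  ultimately show "(\<Sum>\<mu> | horizontal_tableau n \<mu> \<and> orthogonal_partial n k \<mu> \<nu>'. \<tau> \<mu>) = 0"
    by simp
qed

end
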